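(* Let $(X,\mathcal{A})$ be a measurable space. The following statements are equivalent for a $\chi$-ring $S(X,\mathcal{A})$. (1) Each prime ideal in $S(X,\mathcal{A})$ is maximal. (2) $S(X,\mathcal{A})$ is a Von-Neumann regular ring, in the sense that given $f\in S(X,\mathcal{A})$ there exists $g\in S(X,\mathcal{A})$ such that $f=f^2g$. (3) For each $f\in S(X,\mathcal{A})$, $Z(f)\in\mathcal{Z}_S(f)$. (4) For each ideal $I$ in $S(X,\mathcal{A})$, $Z[I]=\{Z(f):f\in I\}$ is an $\mathcal{A}$-filter on $X$, and $Z^{-1}[Z[I]]=I$. (5) The map $Z:\mathcal{I}_S\to\mathcal{A}_X$ given by $I\mapsto Z[I]$ is a bijection from the set $\mathcal{I}_S$ of all ideals in $S(X,\mathcal{A})$ onto the set $\mathcal{A}_X$ of all $\mathcal{A}$-filters on $X$. (6) For all $f,g\in S(X,\mathcal{A})$, $\langle f,g\rangle=\langle f^2+g^2\rangle$. (7) If $P$ is a prime ideal in $S(X,\mathcal{A})$ and $f\in P$, then $Z(f)\in\mathcal{Z}_S[P]$. (8) If $M$ is a maximal ideal in $S(X,\mathcal{A})$ and $f\in M$, then $Z(f)\in\mathcal{Z}_S[M]$. (9) If $Z(f)\subseteq Z(g)$, where $f,g\in S(X,\mathcal{A})$, then $g$ is a multiple of $f$ in the ring $S(X,\mathcal{A})$. (10) Every ideal in $S(X,\mathcal{A})$ is a $\mathcal{Z}_S$-ideal. (11) Every principal ideal in $S(X,\mathcal{A})$ is generated by an idempotent. (12) Every ideal in $S(X,\mathcal{A})$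 is the intersection of all prime ideals which contain it. (13) Every ideal in $S(X,\mathcal{A})$ is the intersection of all maximal ideals which contain it. (14) For any ideal $I$ in $S(X,\mathcal{A})$, $I=\mathcal{Z}_\mathcal{M}^{-1}[\mathcal{Z}_S[I]]\cap S(X,\mathcal{A})$. (15) Each ideal in $S(X,\mathcal{A})$ is a $Z$-ideal.
   Context: A measurable space $(X,\mathcal{A})$ is a nonempty set $X$ with a $\sigma$-algebra $\mathcal{A}$ of subsets of $X$. $\mathcal{M}(X,\mathcal{A})$ is the commutative ring (pointwise operations) of all $\mathcal{A}$-measurable functions $X\to\mathbb{R}$. A $\chi$-ring $S(X,\mathcal{A})$ is a subring of $\mathcal{M}(X,\mathcal{A})$ such that $\chi_A\in S(X,\mathcal{A})$ for every $A\in\mathcal{A}$, where $\chi_A$ is the characteristic function of $A$. "Ideal" (unmodified) always means proper ideal; $\langle f\rangle$ and $\langle f,g\rangle$ denote the ideals of $S(X,\mathcal{A})$ generated by the indicated elements (possibly the whole ring). $Z(f)=\{x\in X: f(x)=0\}$. For a family $\mathcal{F}$ of sets, $Z^{-1}[\mathcal{F}]=\{f\in S(X,\mathcal{A}): Z(f)\in\mathcal{F}\}$. An $\mathcal{A}$-filter on $X$ is a nonempty family of members of $\mathcal{A}$ not containing $\emptyset$, closed under finite intersections and under supersets belonging to $\mathcal{A}$. For $f\in S(X,\mathcal{A})$, $\mathcal{Z}_S(f)=\{E\in\mathcal{A}: \text{there exists } g\in S(X,\mathcal{A}) \text{ with } f(x)g(x)=1 \text{ for all } x\in X\setminus E\}$;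 for an ideal $I$, $\mathcal{Z}_S[I]=\bigcup_{f\in I}\mathcal{Z}_S(f)$, which is an $\mathcal{A}$-filter. For $g\in\mathcal{M}(X,\mathcal{A})$, $\mathcal{Z}_\mathcal{M}(g)=\{E\in\mathcal{A}: \text{there exists } h\in\mathcal{M}(X,\mathcal{A}) \text{ with } g(x)h(x)=1 \text{ for all } x\in X\setminus E\}$; for an $\mathcal{A}$-filter $\mathcal{F}$, $\mathcal{Z}_\mathcal{M}^{-1}[\mathcal{F}]=\{g\in\mathcal{M}(X,\mathcal{A}):\mathcal{Z}_\mathcal{M}(g)\subseteq\mathcal{F}\}$. An ideal $I$ in $S(X,\mathcal{A})$ is a $\mathcal{Z}_S$-ideal if for any $f\in S(X,\mathcal{A})$, $\mathcal{Z}_S(f)\subseteq\mathcal{Z}_S[I]$ implies $f\in I$. An ideal $I$ in a commutative ring $A$ with unity is a $Z$-ideal if for each $a\in I$, $M_a\subseteq I$, where $M_a$ is the intersection of all maximal ideals of $A$ containing $a$. *)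

theory Defs
  imports "HOL-Analysis.Analysis" "HOL-Algebra.Algebra"
begin

text \<open>
  A measurable space \<open>(X, \<A>)\<close> is represented by \<open>M :: 'a measure\<close> with \<open>X = space M\<close> and
  \<open>\<A> = sets M\<close>; the measure carried by \<open>M\<close> is never used. A function on \<open>X\<close> is represented by
  its extensional total function (equal to \<open>undefined\<close> outside \<open>space M\<close>), so that equality in
  the ring is equality of functions on \<open>X\<close>.
\<close>

definition measurable_ring :: "'a measure \<Rightarrow> ('a \<Rightarrow> real) ring" where
  "measurable_ring M =
    \<lparr>carrier = borel_measurable M \<inter> extensional (space M),
     mult = (\<lambda>f g. \<lambda>x\<in>space M. f x * g x),
     one = (\<lambda>x\<in>space M. 1),
     ring.zero = (\<lambda>x\<in>space M. 0),
     ring.add = (\<lambda>f g. \<lambda>x\<in>space M. f x + g x)\<rparr>"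

lemma cring_measurable_ring: "cring (measurable_ring M)"
proof (rule cringI)
  show "abelian_group (measurable_ring M)"
  proof (rule abelian_groupI)
    fix f assume f: "f \<in> carrier (measurable_ring M)"
    let ?g = "\<lambda>x\<in>space M. - f x"
    have "?g \<in> carrier (measurable_ring M)" "?g \<oplus>\<^bsub>measurable_ring M\<^esub> f = \<zero>\<^bsub>measurable_ring M\<^esub>"
      using f by (auto simp: measurable_ring_def fun_eq_iff cong: measurable_cong)
    then show "\<exists>g\<in>carrier (measurable_ring M). g \<oplus>\<^bsub>measurable_ring M\<^esub> f = \<zero>\<^bsub>measurable_ring M\<^esub>"
      by blast
  qed (auto simp: measurable_ring_def extensional_def fun_eq_iff cong: measurable_cong)
  show "comm_monoid (measurable_ring M)"
    by (rule comm_monoidI)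
      (auto simp: measurable_ring_def extensional_def fun_eq_iff cong: measurable_cong)
qed (auto simp: measurable_ring_def extensional_def fun_eq_iff algebra_simps)

definition chi_ring :: "'a measure \<Rightarrow> ('a \<Rightarrow> real) set \<Rightarrow> bool" where
  "chi_ring M S \<longleftrightarrow> subring S (measurable_ring M) \<and>
    (\<forall>A\<in>sets M. (\<lambda>x\<in>space M. indicator A x) \<in> S)"

text \<open>The \<open>\<chi>\<close>-ring \<open>S\<close> as a ring in its own right.\<close>

abbreviation ring_on :: "'a measure \<Rightarrow> ('a \<Rightarrow> real) set \<Rightarrow> ('a \<Rightarrow> real) ring" where
  "ring_on M S \<equiv> (measurable_ring M)\<lparr>carrier := S\<rparr>"

definition zero_set :: "'a measure \<Rightarrow> ('a \<Rightarrow> real) \<Rightarrow> 'a set" where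
  "zero_set M f = {x \<in> space M. f x = 0}"

definition A_filter :: "'a measure \<Rightarrow> 'a set set \<Rightarrow> bool" where
  "A_filter M F \<longleftrightarrow> F \<noteq> {} \<and> F \<subseteq> sets M \<and> {} \<notin> F \<and>
    (\<forall>A\<in>F. \<forall>B\<in>F. A \<inter> B \<in> F) \<and>
    (\<forall>A\<in>F. \<forall>B\<in>sets M. A \<subseteq> B \<longrightarrow> B \<in> F)"

text \<open>
  \<open>ZS M S f\<close> is \<open>\<Z>\<^sub>S(f)\<close>; instantiating \<open>S\<close> with the full carrier of \<open>measurable_ring M\<close>
  gives \<open>\<Z>\<^sub>\<M>(f)\<close>.
\<close>

definition ZS :: "'a measure \<Rightarrow> ('a \<Rightarrow> real) set \<Rightarrow> ('a \<Rightarrow> real) \<Rightarrow> 'a set set" where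
  "ZS M S f = {E \<in> sets M. \<exists>g\<in>S. \<forall>x\<in>space M - E. f x * g x = 1}"

definition ZS_image :: "'a measure \<Rightarrow> ('a \<Rightarrow> real) set \<Rightarrow> ('a \<Rightarrow> real) set \<Rightarrow> 'a set set" where
  "ZS_image M S I = (\<Union>f\<in>I. ZS M S f)"

abbreviation ZM :: "'a measure \<Rightarrow> ('a \<Rightarrow> real) \<Rightarrow> 'a set set" where
  "ZM M \<equiv> ZS M (carrier (measurable_ring M))"

definition ZM_preimage :: "'a measure \<Rightarrow> 'a set set \<Rightarrow> ('a \<Rightarrow> real) set" where
  "ZM_preimage M F = {g \<in> carrier (measurable_ring M). ZM M g \<subseteq> F}"

text \<open>Unlike \<^const>\<open>ideal\<close>, which admits the whole ring, an ideal here is always proper.\<close>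

definition proper_ideal :: "'b set \<Rightarrow> ('b, 'c) ring_scheme \<Rightarrow> bool" where
  "proper_ideal I R \<longleftrightarrow> ideal I R \<and> I \<noteq> carrier R"

definition ZS_ideal :: "'a measure \<Rightarrow> ('a \<Rightarrow> real) set \<Rightarrow> ('a \<Rightarrow> real) set \<Rightarrow> bool" where
  "ZS_ideal M S I \<longleftrightarrow> proper_ideal I (ring_on M S) \<and>
    (\<forall>f\<in>S. ZS M S f \<subseteq> ZS_image M S I \<longrightarrow> f \<in> I)"

text \<open>
  \<open>M_of R a\<close> is the intersection \<open>M\<^sub>a\<close> of all maximal ideals containing \<open>a\<close>. Intersecting with
  the carrier makes the empty intersection the whole ring.
\<close>

definition M_of :: "('b, 'c) ring_scheme \<Rightarrow> 'b \<Rightarrow> 'b set" where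
  "M_of R a = carrier R \<inter> \<Inter>{N. maximalideal N R \<and> a \<in> N}"

definition Z_ideal :: "'b set \<Rightarrow> ('b, 'c) ring_scheme \<Rightarrow> bool" where
  "Z_ideal I R \<longleftrightarrow> proper_ideal I R \<and> (\<forall>a\<in>I. M_of R a \<subseteq> I)"

definition all_equivalent :: "bool list \<Rightarrow> bool" where
  "all_equivalent ps \<longleftrightarrow> (\<forall>p\<in>set ps. \<forall>q\<in>set ps. p \<longleftrightarrow> q)"

end

theory Submission
  imports Defs
begin

text \<open>
  Every item is shown to be equivalent to von Neumann regularity, i.e. to \<open>f \<in> \<langle>f\<^sup>2\<rangle>\<close> for
  all \<open>f\<close>. Most converses follow by testing the item on the ideal \<open>\<langle>f\<^sup>2\<rangle>\<close>, which none of the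
  constructions involved (prime or maximal ideals above it, zero sets, \<open>\<Z>\<^sub>S\<close>) distinguishes
  from \<open>\<langle>f\<rangle>\<close>. In the other direction, \<open>E \<in> \<Z>\<^sub>S[I]\<close> means that the characteristic
  function of the complement of \<open>E\<close> lies in \<open>I\<close>; if the ring is regular, then
  \<open>f \<in> I\<close> iff \<open>Z(f) \<in> \<Z>\<^sub>S[I]\<close>, so ideals are governed by their zero sets.
  That regularity follows if all primes are maximal uses reducedness and
  a prime ideal avoiding the multiplicative set of all \<open>f\<^sup>n(1 - fx)\<close>.
\<close>

section \<open>Von Neumann regular commutative rings\<close>

definition von_neumann_regular :: "('b, 'c) ring_scheme \<Rightarrow> bool" where
  "von_neumann_regular R \<longleftrightarrow>
    (\<forall>a\<in>carrier R. \<exists>b\<in>carrier R. a = (a \<otimes>\<^bsub>R\<^esub> a) \<otimes>\<^bsub>R\<^esub> b)"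

context cring
begin

section \<open>Proper ideals and Zorn's lemma\<close>

lemma proper_ideal_iff_one_notin: "proper_ideal I R \<longleftrightarrow> ideal I R \<and> \<one> \<notin> I"
  unfolding proper_ideal_def by (metis ideal.one_imp_carrier one_closed)

text \<open>The ideal is \<open>I + PIdl a\<close>. Only the shape of its elements is exported,
  because the maximality arguments work with a single equation
  \<open>t = p \<oplus> x \<otimes> a\<close>.\<close>

lemma ideal_adjoin:
  assumes "ideal I R" "a \<in> carrier R"
  obtains J where "ideal J R" "I \<subseteq> J" "a \<in> J"
    "\<And>t. t \<in> J \<Longrightarrow> \<exists>p\<in>I. \<exists>x\<in>carrier R. t = p \<oplus> x \<otimes> a"
proof -
  interpret I: ideal I R by fact
  interpret P: ideal "PIdl a" R using assms(2) by (rule cgenideal_ideal)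
  let ?J = "set_add R I (PIdl a)"
  have J: "ideal ?J R"
    by (rule add_ideals) (fact assms(1) P.ideal_axioms)+
  have incl: "I \<subseteq> ?J"
  proof
    fix p assume p: "p \<in> I"
    then have "p = p \<oplus> \<zero>" by (simp add: I.Icarr)
    with p show "p \<in> ?J"
      unfolding set_add_def' using P.zero_closed by blast
  qed
  have "a = \<zero> \<oplus> a" using assms(2) by simp
  then have mem: "a \<in> ?J"
    unfolding set_add_def' using I.zero_closed cgenideal_self[OF assms(2)] by blast
  have "\<exists>p\<in>I. \<exists>x\<in>carrier R. t = p \<oplus> x \<otimes> a" if "t \<in> ?J" for t
    using that unfolding set_add_def' cgenideal_def by blast
  with that J incl mem show thesis by blast
qed

text \<open>Zorn's lemma: disjointness from \<open>T\<close> survives unions of chains. A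
  multiplicative \<open>T\<close> will give prime ideals, and \<open>T = {\<one>}\<close> maximal
  ideals.\<close>

lemma exists_maximal_disjoint_ideal:
  assumes "ideal I R" "I \<inter> T = {}"
  obtains P where "ideal P R" "I \<subseteq> P" "P \<inter> T = {}"
    "\<And>J. ideal J R \<Longrightarrow> P \<subseteq> J \<Longrightarrow> J \<inter> T = {} \<Longrightarrow> J = P"
proof -
  let ?\<A> = "{J. ideal J R \<and> I \<subseteq> J \<and> J \<inter> T = {}}"
  have "\<exists>P\<in>?\<A>. \<forall>J\<in>?\<A>. P \<subseteq> J \<longrightarrow> J = P"
  proof (rule subset_Zorn_nonempty)
    show "?\<A> \<noteq> {}" using assms by blast
    fix C assume C: "C \<noteq> {}" "subset.chain ?\<A> C"
    then have "subset.chain {J. ideal J R} C"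
      unfolding pred_on.chain_def by blast
    with C(1) have "ideal (\<Union>C) R"
      using chain_Union_is_ideal[of C] by simp
    with C show "\<Union>C \<in> ?\<A>"
      unfolding pred_on.chain_def by blast
  qed
  then obtain P where P: "P \<in> ?\<A>" and max: "\<forall>J\<in>?\<A>. P \<subseteq> J \<longrightarrow> J = P" ..
  show thesis
  proof
    show "ideal P R" "I \<subseteq> P" "P \<inter> T = {}" using P by auto
    then show "J = P" if "ideal J R" "P \<subseteq> J" "J \<inter> T = {}" for J
      using max that by simp
  qed
qed

text \<open>Krull's argument: if \<open>a\<close> and \<open>b\<close> lie outside the maximal
  \<open>P\<close>, then adjoining either one makes the ideal meet \<open>T\<close>. If
  \<open>a \<otimes> b\<close> were in \<open>P\<close>, the product of the two elements so found
  would lie in both \<open>T\<close> and \<open>P\<close>.\<close>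

lemma exists_prime_disjoint:
  assumes "ideal I R" "I \<inter> T = {}" "T \<subseteq> carrier R" "\<one> \<in> T"
    and T_mult: "\<And>s t. s \<in> T \<Longrightarrow> t \<in> T \<Longrightarrow> s \<otimes> t \<in> T"
  obtains P where "primeideal P R" "I \<subseteq> P" "P \<inter> T = {}"
proof -
  obtain P where P: "ideal P R" "I \<subseteq> P" "P \<inter> T = {}"
    and max: "\<And>J. ideal J R \<Longrightarrow> P \<subseteq> J \<Longrightarrow> J \<inter> T = {} \<Longrightarrow> J = P"
    using exists_maximal_disjoint_ideal[OF assms(1,2)] by blast
  interpret P: ideal P R by fact
  have meets: "\<exists>t\<in>T. \<exists>p\<in>P. \<exists>x\<in>carrier R. t = p \<oplus> x \<otimes> a"
    if a: "a \<in> carrier R" "a \<notin> P" for a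
  proof -
    obtain J where J: "ideal J R" "P \<subseteq> J" "a \<in> J"
      "\<And>t. t \<in> J \<Longrightarrow> \<exists>p\<in>P. \<exists>x\<in>carrier R. t = p \<oplus> x \<otimes> a"
      using ideal_adjoin[OF P(1) a(1)] by blast
    with max[OF J(1,2)] a(2) obtain t where "t \<in> J" "t \<in> T" by blast
    with J(4) show ?thesis by blast
  qed
  have "primeideal P R"
  proof (rule primeidealI[OF P(1) is_cring])
    show "carrier R \<noteq> P" using P(3) assms(4) by auto
    fix a b assume ab: "a \<in> carrier R" "b \<in> carrier R" "a \<otimes> b \<in> P"
    show "a \<in> P \<or> b \<in> P"
    proof (rule ccontr)
      assume "\<not> ?thesis"
      then have "a \<notin> P" "b \<notin> P" by auto
      with meets ab obtain s p x t q y where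
        s: "s \<in> T" "p \<in> P" "x \<in> carrier R" "s = p \<oplus> x \<otimes> a" and
        t: "t \<in> T" "q \<in> P" "y \<in> carrier R" "t = q \<oplus> y \<otimes> b" by meson
      \<comment> \<open>Expanded so that each summand carries a factor \<open>p\<close>,
        \<open>q\<close> or \<open>a \<otimes> b\<close> from \<open>P\<close>.\<close>
      have "s \<otimes> t = p \<otimes> t \<oplus> (q \<otimes> (x \<otimes> a) \<oplus> (a \<otimes> b) \<otimes> (x \<otimes> y))"
        using s t ab(1,2) P.Icarr by algebra
      moreover have "\<dots> \<in> P"
        using P.I_r_closed[OF s(2), of t] P.I_r_closed[OF t(2), of "x \<otimes> a"]
          P.I_r_closed[OF ab(3), of "x \<otimes> y"] s(3) t(1,3) ab(1) assms(3)
        by (auto intro!: P.a_closed)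
      ultimately show False using T_mult[OF s(1) t(1)] P(3) by auto
    qed
  qed
  with P(2,3) that show thesis by blast
qed

text \<open>Avoiding \<open>{\<one>}\<close> is the same as being proper, so maximality among such
  ideals is maximality in the usual sense.\<close>

lemma exists_maximalideal_above:
  assumes "proper_ideal I R"
  obtains N where "maximalideal N R" "I \<subseteq> N"
proof -
  obtain N where N: "ideal N R" "I \<subseteq> N" "N \<inter> {\<one>} = {}"
    and max: "\<And>J. ideal J R \<Longrightarrow> N \<subseteq> J \<Longrightarrow> J \<inter> {\<one>} = {} \<Longrightarrow> J = N"
    using exists_maximal_disjoint_ideal[of I "{\<one>}"] assms
    by (auto simp: proper_ideal_iff_one_notin)
  have "maximalideal N R"
  proof (rule maximalidealI[OF N(1)])
    show "carrier R \<noteq> N" using N(3) by auto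
    show "J = N \<or> J = carrier R" if "ideal J R" "N \<subseteq> J" for J
      using max[OF that] ideal.one_imp_carrier[OF that(1)] by auto
  qed
  with N(2) that show thesis by blast
qed

section \<open>Regularity and maximality of primes\<close>

text \<open>For \<open>a\<close> outside \<open>P\<close>, the product
  \<open>a \<otimes> (\<one> \<ominus> a \<otimes> b)\<close> is zero, so
  \<open>\<one> \<ominus> a \<otimes> b\<close> lies in \<open>P\<close>. An ideal above
  \<open>P\<close> that contains \<open>a\<close> therefore contains \<open>\<one>\<close>.\<close>

lemma von_neumann_regular_imp_prime_maximal:
  assumes "von_neumann_regular R" "primeideal P R"
  shows "maximalideal P R"
proof -
  interpret P: primeideal P R by fact
  show ?thesis
  proof (rule maximalidealI[OF P.is_ideal P.I_notcarr])
    fix J assume J: "ideal J R" "P \<subseteq> J"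
    interpret J: ideal J R by fact
    show "J = P \<or> J = carrier R"
    proof (cases "J \<subseteq> P")
      case False
      then obtain a where a: "a \<in> J" "a \<notin> P" by blast
      with assms(1) obtain b where b: "b \<in> carrier R" "a = (a \<otimes> a) \<otimes> b"
        unfolding von_neumann_regular_def using J.Icarr by blast
      have ac: "a \<in> carrier R" using a(1) by (rule J.Icarr)
      have "a \<otimes> (\<one> \<ominus> a \<otimes> b) = a \<ominus> (a \<otimes> a) \<otimes> b"
        using ac b(1) by algebra
      also have "\<dots> = \<zero>" using b ac by simp
      finally have "\<one> \<ominus> a \<otimes> b \<in> P"
        using P.I_prime[of a "\<one> \<ominus> a \<otimes> b"] a ac b(1) by auto
      moreover have "\<one> = (\<one> \<ominus> a \<otimes> b) \<oplus> a \<otimes> b"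
        using ac b(1) by algebra
      ultimately have "\<one> \<in> J"
        using J(2) J.a_closed J.I_r_closed[OF a(1) b(1)] by (metis subsetD)
      then show ?thesis using J.one_imp_carrier by blast
    qed (use J(2) in blast)
  qed
qed

text \<open>If \<open>T\<close> omitted \<open>\<zero>\<close>, some prime \<open>P\<close> would
  miss \<open>T\<close> and hence omit \<open>a\<close>. As \<open>P\<close> is maximal,
  \<open>\<one> = p \<oplus> x \<otimes> a\<close> with \<open>p\<close> in \<open>P\<close>, but
  then \<open>p = \<one> \<ominus> a \<otimes> x\<close> is in \<open>T\<close>. So some
  \<open>a [^] n \<otimes> (\<one> \<ominus> a \<otimes> x)\<close> vanishes, and reducedness lowers
  the exponent to 1.\<close>

lemma reduced_prime_maximal_imp_von_neumann_regular:
  assumes red: "\<And>a n. a \<in> carrier R \<Longrightarrow> a [^] (n::nat) = \<zero> \<Longrightarrow> a = \<zero>"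
    and max: "\<And>P. primeideal P R \<Longrightarrow> maximalideal P R"
  shows "von_neumann_regular R"
  unfolding von_neumann_regular_def
proof
  fix a assume a: "a \<in> carrier R"
  define T where "T = {a [^] n \<otimes> (\<one> \<ominus> a \<otimes> x) | (n::nat) x. x \<in> carrier R}"
  have one: "\<one> \<in> T"
    unfolding T_def using a by (intro CollectI exI[of _ "0::nat"] exI[of _ \<zero>]) (simp add: minus_eq)
  have mult: "s \<otimes> t \<in> T" if "s \<in> T" "t \<in> T" for s t
  proof -
    from that obtain n x m y where
      s: "x \<in> carrier R" "s = a [^] (n::nat) \<otimes> (\<one> \<ominus> a \<otimes> x)" and
      t: "y \<in> carrier R" "t = a [^] (m::nat) \<otimes> (\<one> \<ominus> a \<otimes> y)"
      unfolding T_def by blast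
    \<comment> \<open>The product of \<open>\<one> \<ominus> a \<otimes> x\<close> and
      \<open>\<one> \<ominus> a \<otimes> y\<close> has the same form again.\<close>
    have "s \<otimes> t = (a [^] n \<otimes> a [^] m) \<otimes> (\<one> \<ominus> a \<otimes> (x \<oplus> y \<ominus> a \<otimes> x \<otimes> y))"
      unfolding s(2) t(2) using s(1) t(1) a nat_pow_closed[OF a, of n] nat_pow_closed[OF a, of m]
      by algebra
    also have "\<dots> = a [^] (n + m) \<otimes> (\<one> \<ominus> a \<otimes> (x \<oplus> y \<ominus> a \<otimes> x \<otimes> y))"
      using a by (simp add: nat_pow_mult)
    finally show ?thesis unfolding T_def using s(1) t(1) a by blast
  qed
  have sub: "T \<subseteq> carrier R" unfolding T_def using a by auto
  have "\<zero> \<in> T"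
  proof (rule ccontr)
    assume "\<zero> \<notin> T"
    then have "{\<zero>} \<inter> T = {}" by blast
    from exists_prime_disjoint[OF zeroideal this sub one mult]
    obtain P where P: "primeideal P R" "P \<inter> T = {}" by metis
    interpret P: maximalideal P R using max P(1) by blast
    \<comment> \<open>Exponent 1 and \<open>x = \<zero>\<close> put \<open>a\<close> itself into
      \<open>T\<close>.\<close>
    have "a \<otimes> \<one> \<in> T"
      unfolding T_def using a
      by (intro CollectI exI[of _ "1::nat"] exI[of _ \<zero>]) (simp add: minus_eq)
    then have "a \<notin> P" using P(2) a by auto
    obtain J where J: "ideal J R" "P \<subseteq> J" "a \<in> J"
      "\<And>t. t \<in> J \<Longrightarrow> \<exists>p\<in>P. \<exists>x\<in>carrier R. t = p \<oplus> x \<otimes> a"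
      using ideal_adjoin[OF P.is_ideal a] by blast
    have "J \<subseteq> carrier R" using ideal.Icarr[OF J(1)] by blast
    then have "J = carrier R"
      using P.I_maximal[OF J(1,2)] J(3) \<open>a \<notin> P\<close> by blast
    then obtain p x where p: "p \<in> P" "x \<in> carrier R" "\<one> = p \<oplus> x \<otimes> a"
      using J(4) one_closed by blast
    have pc: "p \<in> carrier R" using p(1) by (rule P.Icarr)
    have "p = (p \<oplus> x \<otimes> a) \<ominus> a \<otimes> x" using p(2) pc a by algebra
    also have "\<dots> = a [^] (0::nat) \<otimes> (\<one> \<ominus> a \<otimes> x)"
      using p(2) a by (simp flip: p(3))
    finally have "p = a [^] (0::nat) \<otimes> (\<one> \<ominus> a \<otimes> x)" .
    then have "p \<in> T" unfolding T_def using p(2) by blast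
    with p(1) P(2) show False by blast
  qed
  then obtain n x where x: "x \<in> carrier R" "a [^] (n::nat) \<otimes> (\<one> \<ominus> a \<otimes> x) = \<zero>"
    unfolding T_def by force
  let ?d = "a \<otimes> (\<one> \<ominus> a \<otimes> x)"
  \<comment> \<open>The power \<open>Suc n\<close> leaves enough factors to split off the vanishing
    product.\<close>
  have "?d [^] Suc n = (a [^] n \<otimes> (\<one> \<ominus> a \<otimes> x)) \<otimes> (a \<otimes> (\<one> \<ominus> a \<otimes> x) [^] n)"
    using a x(1) nat_pow_closed[OF a, of n] nat_pow_closed[of "\<one> \<ominus> a \<otimes> x" n]
    by (simp add: nat_pow_distrib m_ac)
  then have "?d [^] Suc n = \<zero>" using a x(1) by (simp only: x(2)) simp
  then have "?d = \<zero>" using a x(1) by (intro red[of ?d "Suc n"]) simp_all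
  moreover have "a = ?d \<oplus> (a \<otimes> a) \<otimes> x" using a x(1) by algebra
  ultimately have "a = (a \<otimes> a) \<otimes> x" using a x(1) by simp
  with x(1) show "\<exists>b\<in>carrier R. a = (a \<otimes> a) \<otimes> b" by blast
qed

section \<open>Criteria in terms of ideals\<close>

text \<open>When \<open>PIdl (a \<otimes> a)\<close> is the whole ring, membership of
  \<open>a\<close> is trivial. Hence conditions that speak of proper ideals alone suffice as a
  test.\<close>

lemma von_neumann_regularI:
  assumes "\<And>a. a \<in> carrier R \<Longrightarrow> proper_ideal (PIdl (a \<otimes> a)) R \<Longrightarrow> a \<in> PIdl (a \<otimes> a)"
  shows "von_neumann_regular R"
  unfolding von_neumann_regular_def
proof
  fix a assume a: "a \<in> carrier R"
  have "a \<in> PIdl (a \<otimes> a)"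
    using assms[OF a] a cgenideal_ideal[of "a \<otimes> a"] unfolding proper_ideal_def by auto
  then obtain b where "b \<in> carrier R" "a = b \<otimes> (a \<otimes> a)"
    unfolding cgenideal_def by blast
  with a show "\<exists>b\<in>carrier R. a = (a \<otimes> a) \<otimes> b"
    by (metis m_closed m_comm)
qed

text \<open>The element \<open>e = \<one> \<ominus> a \<otimes> b\<close> annihilates
  \<open>a\<close>. Adjoining it to \<open>I\<close> keeps the ideal proper: multiplying
  \<open>\<one> = p \<oplus> x \<otimes> e\<close> by \<open>a\<close> would give
  \<open>a = p \<otimes> a\<close>, an element of \<open>I\<close>. A maximal ideal containing
  \<open>e\<close> omits \<open>a\<close> because
  \<open>e \<oplus> a \<otimes> b = \<one>\<close>.\<close>

lemma von_neumann_regular_maximal_avoiding: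
  assumes "von_neumann_regular R" "ideal I R" "a \<in> carrier R" "a \<notin> I"
  obtains N where "maximalideal N R" "I \<subseteq> N" "a \<notin> N"
proof -
  interpret I: ideal I R by fact
  obtain b where b: "b \<in> carrier R" "a = (a \<otimes> a) \<otimes> b"
    using assms(1,3) unfolding von_neumann_regular_def by blast
  define e where "e = \<one> \<ominus> a \<otimes> b"
  have e: "e \<in> carrier R" unfolding e_def using assms(3) b(1) by simp
  have ae: "a \<otimes> e = \<zero>"
  proof -
    have "a \<otimes> e = a \<ominus> (a \<otimes> a) \<otimes> b"
      unfolding e_def using assms(3) b(1) by algebra
    then show ?thesis using b assms(3) by simp
  qed
  obtain J where J: "ideal J R" "I \<subseteq> J" "e \<in> J"
    "\<And>t. t \<in> J \<Longrightarrow> \<exists>p\<in>I. \<exists>x\<in>carrier R. t = p \<oplus> x \<otimes> e"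
    using ideal_adjoin[OF assms(2) e] by blast
  have "\<one> \<notin> J"
  proof
    assume "\<one> \<in> J"
    then obtain p x where p: "p \<in> I" "x \<in> carrier R" "\<one> = p \<oplus> x \<otimes> e"
      using J(4) by blast
    have pc: "p \<in> carrier R" using p(1) by (rule I.Icarr)
    have "a = (p \<oplus> x \<otimes> e) \<otimes> a" using assms(3) by (simp flip: p(3))
    also have "\<dots> = p \<otimes> a \<oplus> x \<otimes> (a \<otimes> e)" using pc p(2) e assms(3) by algebra
    also have "\<dots> = p \<otimes> a" using ae pc p(2) assms(3) by simp
    also have "\<dots> \<in> I" using p(1) assms(3) by (rule I.I_r_closed)
    finally show False using assms(4) by simp
  qed
  with J(1) have "proper_ideal J R" by (simp add: proper_ideal_iff_one_notin)
  then obtain N where N: "maximalideal N R" "J \<subseteq> N" by (rule exists_maximalideal_above)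
  interpret N: maximalideal N R by fact
  have "a \<notin> N"
  proof
    assume "a \<in> N"
    moreover have "e \<in> N" using N(2) J(3) by blast
    ultimately have "e \<oplus> a \<otimes> b \<in> N" using b(1) by (intro N.a_closed N.I_r_closed)
    moreover have "e \<oplus> a \<otimes> b = \<one>" unfolding e_def using assms(3) b(1) by algebra
    ultimately show False using N.one_imp_carrier N.I_notcarr by simp
  qed
  with N J(2) that show thesis by blast
qed

lemma primeideal_square:
  assumes "primeideal P R" "a \<in> carrier R" "a \<otimes> a \<in> P"
  shows "a \<in> P"
  using primeideal.I_prime[OF assms(1,2,2,3)] by simp

lemma maximalideal_square:
  assumes "maximalideal N R" "a \<in> carrier R" "a \<otimes> a \<in> N"
  shows "a \<in> N"
  by (rule primeideal_square[OF maximalideal_prime[OF assms(1)] assms(2,3)])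

text \<open>Forwards, the separating maximal ideal is prime. Backwards, every prime above
  \<open>PIdl (a \<otimes> a)\<close> contains \<open>a\<close>.\<close>

lemma von_neumann_regular_iff_Inter_primes:
  "von_neumann_regular R \<longleftrightarrow>
    (\<forall>I. proper_ideal I R \<longrightarrow> I = carrier R \<inter> \<Inter>{P. primeideal P R \<and> I \<subseteq> P})"
proof
  assume reg: "von_neumann_regular R"
  show "\<forall>I. proper_ideal I R \<longrightarrow> I = carrier R \<inter> \<Inter>{P. primeideal P R \<and> I \<subseteq> P}"
  proof (intro allI impI equalityI subsetI)
    fix I a assume I: "proper_ideal I R" and a: "a \<in> carrier R \<inter> \<Inter>{P. primeideal P R \<and> I \<subseteq> P}"
    show "a \<in> I"
    proof (rule ccontr)
      assume "a \<notin> I"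
      with I a obtain N where "maximalideal N R" "I \<subseteq> N" "a \<notin> N"
        unfolding proper_ideal_def using von_neumann_regular_maximal_avoiding[OF reg] by (metis IntD1)
      with a show False using maximalideal_prime by blast
    qed
  qed (use ideal.Icarr in \<open>auto simp: proper_ideal_def\<close>)
next
  assume *: "\<forall>I. proper_ideal I R \<longrightarrow> I = carrier R \<inter> \<Inter>{P. primeideal P R \<and> I \<subseteq> P}"
  show "von_neumann_regular R"
  proof (rule von_neumann_regularI)
    fix a assume a: "a \<in> carrier R" "proper_ideal (PIdl (a \<otimes> a)) R"
    have "a \<otimes> a \<in> PIdl (a \<otimes> a)" using a(1) by (simp add: cgenideal_self)
    then have "a \<in> P" if "primeideal P R" "PIdl (a \<otimes> a) \<subseteq> P" for P
      using that primeideal_square[OF that(1) a(1)] by blast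
    with a(1) have "a \<in> carrier R \<inter> \<Inter>{P. primeideal P R \<and> PIdl (a \<otimes> a) \<subseteq> P}" by blast
    then show "a \<in> PIdl (a \<otimes> a)" using * a(2) by blast
  qed
qed

lemma von_neumann_regular_iff_Inter_maximals:
  "von_neumann_regular R \<longleftrightarrow>
    (\<forall>I. proper_ideal I R \<longrightarrow> I = carrier R \<inter> \<Inter>{N. maximalideal N R \<and> I \<subseteq> N})"
proof
  assume reg: "von_neumann_regular R"
  show "\<forall>I. proper_ideal I R \<longrightarrow> I = carrier R \<inter> \<Inter>{N. maximalideal N R \<and> I \<subseteq> N}"
  proof (intro allI impI equalityI subsetI)
    fix I a assume I: "proper_ideal I R" and a: "a \<in> carrier R \<inter> \<Inter>{N. maximalideal N R \<and> I \<subseteq> N}"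
    show "a \<in> I"
    proof (rule ccontr)
      assume "a \<notin> I"
      with I a obtain N where "maximalideal N R" "I \<subseteq> N" "a \<notin> N"
        unfolding proper_ideal_def using von_neumann_regular_maximal_avoiding[OF reg] by (metis IntD1)
      with a show False by blast
    qed
  qed (use ideal.Icarr in \<open>auto simp: proper_ideal_def\<close>)
next
  assume *: "\<forall>I. proper_ideal I R \<longrightarrow> I = carrier R \<inter> \<Inter>{N. maximalideal N R \<and> I \<subseteq> N}"
  show "von_neumann_regular R"
  proof (rule von_neumann_regularI)
    fix a assume a: "a \<in> carrier R" "proper_ideal (PIdl (a \<otimes> a)) R"
    have "a \<otimes> a \<in> PIdl (a \<otimes> a)" using a(1) by (simp add: cgenideal_self)
    then have "a \<in> N" if "maximalideal N R" "PIdl (a \<otimes> a) \<subseteq> N" for N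
      using that maximalideal_square[OF that(1) a(1)] by blast
    with a(1) have "a \<in> carrier R \<inter> \<Inter>{N. maximalideal N R \<and> PIdl (a \<otimes> a) \<subseteq> N}" by blast
    then show "a \<in> PIdl (a \<otimes> a)" using * a(2) by blast
  qed
qed

text \<open>Forwards, a maximal ideal that separates \<open>b\<close> from \<open>I\<close> contains
  \<open>a\<close>, so \<open>b\<close> is not in \<open>M_of R a\<close>. Backwards,
  \<open>a\<close> lies in \<open>M_of R (a \<otimes> a)\<close>.\<close>

lemma von_neumann_regular_iff_Z_ideals:
  "von_neumann_regular R \<longleftrightarrow> (\<forall>I. proper_ideal I R \<longrightarrow> Z_ideal I R)"
proof
  assume reg: "von_neumann_regular R"
  show "\<forall>I. proper_ideal I R \<longrightarrow> Z_ideal I R"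
  proof (intro allI impI)
    fix I assume I: "proper_ideal I R"
    have "b \<in> I" if "a \<in> I" "b \<in> M_of R a" for a b
    proof (rule ccontr)
      assume "b \<notin> I"
      with I that(2) obtain N where "maximalideal N R" "I \<subseteq> N" "b \<notin> N"
        unfolding proper_ideal_def M_of_def
        using von_neumann_regular_maximal_avoiding[OF reg] by (metis IntD1)
      with that show False unfolding M_of_def by blast
    qed
    with I show "Z_ideal I R" unfolding Z_ideal_def by blast
  qed
next
  assume *: "\<forall>I. proper_ideal I R \<longrightarrow> Z_ideal I R"
  show "von_neumann_regular R"
  proof (rule von_neumann_regularI)
    fix a assume a: "a \<in> carrier R" "proper_ideal (PIdl (a \<otimes> a)) R"
    then have "M_of R (a \<otimes> a) \<subseteq> PIdl (a \<otimes> a)"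
      using * cgenideal_self[of "a \<otimes> a"] unfolding Z_ideal_def by simp
    moreover have "a \<in> M_of R (a \<otimes> a)"
      unfolding M_of_def using a(1) maximalideal_square[OF _ a(1)] by blast
    ultimately show "a \<in> PIdl (a \<otimes> a)" by blast
  qed
qed

text \<open>From \<open>a = (a \<otimes> a) \<otimes> b\<close> the element
  \<open>e = a \<otimes> b\<close> satisfies \<open>a \<otimes> e = a\<close>, which makes it
  idempotent and a generator of the same ideal. Conversely \<open>a = x \<otimes> e\<close> gives
  \<open>a \<otimes> e = a\<close>, and substituting \<open>e = b \<otimes> a\<close> yields
  regularity. The ideal \<open>J\<close> may be the whole ring.\<close>

lemma von_neumann_regular_iff_idempotent_generators:
  "von_neumann_regular R \<longleftrightarrow>
    (\<forall>J. principalideal J R \<longrightarrow> (\<exists>e\<in>carrier R. e \<otimes> e = e \<and> J = Idl {e}))"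
proof
  assume reg: "von_neumann_regular R"
  show "\<forall>J. principalideal J R \<longrightarrow> (\<exists>e\<in>carrier R. e \<otimes> e = e \<and> J = Idl {e})"
  proof (intro allI impI)
    fix J assume "principalideal J R"
    then have "\<exists>a\<in>carrier R. J = Idl {a}" by (rule principalideal.generate)
    then obtain a where a: "a \<in> carrier R" "J = Idl {a}" by blast
    from a(1) obtain b where b: "b \<in> carrier R" "a = (a \<otimes> a) \<otimes> b"
      using reg unfolding von_neumann_regular_def by blast
    define e where "e = a \<otimes> b"
    have e: "e \<in> carrier R" unfolding e_def using a(1) b(1) by simp
    have "a \<otimes> e = (a \<otimes> a) \<otimes> b" unfolding e_def using a(1) b(1) by (simp add: m_assoc)
    then have ae: "a \<otimes> e = a" by (simp only: b(2)[symmetric])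
    have "e \<otimes> e = (a \<otimes> e) \<otimes> b"
      using a(1) b(1) e unfolding e_def by algebra
    then have "e \<otimes> e = e" unfolding ae e_def[symmetric] .
    moreover have "PIdl a = PIdl e"
    proof (rule equalityI)
      show "PIdl a \<subseteq> PIdl e"
      proof (rule cgenideal_minimal[OF cgenideal_ideal[OF e]])
        show "a \<in> PIdl e"
          unfolding cgenideal_def by (rule CollectI, rule exI[of _ a]) (simp add: ae a(1))
      qed
      show "PIdl e \<subseteq> PIdl a"
      proof (rule cgenideal_minimal[OF cgenideal_ideal[OF a(1)]])
        show "e \<in> PIdl a"
          unfolding cgenideal_def e_def
          by (rule CollectI, rule exI[of _ b]) (simp add: m_comm[OF a(1) b(1)] b(1))
      qed
    qed
    ultimately show "\<exists>e\<in>carrier R. e \<otimes> e = e \<and> J = Idl {e}"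
      unfolding a(2) cgenideal_eq_genideal[OF a(1), symmetric]
      using e cgenideal_eq_genideal[OF e] by blast
  qed
next
  assume *: "\<forall>J. principalideal J R \<longrightarrow> (\<exists>e\<in>carrier R. e \<otimes> e = e \<and> J = Idl {e})"
  show "von_neumann_regular R"
    unfolding von_neumann_regular_def
  proof
    fix a assume a: "a \<in> carrier R"
    obtain e where e: "e \<in> carrier R" "e \<otimes> e = e" and eq: "PIdl a = Idl {e}"
      using *[rule_format, OF cgenideal_is_principalideal[OF a]] by blast
    have "a \<in> PIdl e"
      using cgenideal_self[OF a] unfolding eq cgenideal_eq_genideal[OF e(1)] .
    then obtain x where x: "x \<in> carrier R" "a = x \<otimes> e"
      unfolding cgenideal_def by blast
    have "e \<in> PIdl a" unfolding eq using e(1) by (rule genideal_self')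
    then obtain b where b: "b \<in> carrier R" "e = b \<otimes> a"
      unfolding cgenideal_def by blast
    have "a \<otimes> e = a" unfolding x(2) using x(1) e by (simp add: m_assoc)
    moreover have "a \<otimes> (b \<otimes> a) = (a \<otimes> a) \<otimes> b" using a b(1) by algebra
    ultimately have "a = (a \<otimes> a) \<otimes> b" unfolding b(2) by simp
    with b(1) show "\<exists>b\<in>carrier R. a = (a \<otimes> a) \<otimes> b" by blast
  qed
qed

end

section \<open>\<open>\<chi>\<close>-rings\<close>

text \<open>\<open>R\<close> is tied to the concrete ring by an equation, so that ring notation
  refers to it and the record is unfolded on demand.\<close>

locale chi_subring =
  fixes M :: "'a measure" and S :: "('a \<Rightarrow> real) set" and R :: "('a \<Rightarrow> real) ring" (structure)
  assumes chi_ring: "chi_ring M S"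
    and R_eq: "R = ring_on M S"
begin

section \<open>Pointwise computation in \<open>S\<close>\<close>

lemma subring_S: "subring S (measurable_ring M)"
  using chi_ring unfolding chi_ring_def by blast

sublocale cring R
proof -
  interpret MR: cring "measurable_ring M" by (rule cring_measurable_ring)
  show "cring R"
    unfolding R_eq
    using MR.subcring_iff MR.subcringI'[OF subring_S] subringE(1)[OF subring_S] by blast
qed

lemma carrier_eq [simp]: "carrier R = S"
  by (simp add: R_eq)

text \<open>The operations are pointwise for arbitrary functions on \<open>space M\<close>;
  \<open>ZS_square\<close> applies this to the full ring of measurable functions.\<close>

lemma ring_apply [simp]:
  assumes "x \<in> space M"
  shows "(f \<otimes> g) x = f x * g x" "(f \<oplus> g) x = f x + g x" "\<one> x = 1" "\<zero> x = 0"
  using assms by (simp_all add: R_eq measurable_ring_def)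

lemma S_subset: "S \<subseteq> carrier (measurable_ring M)"
  by (rule subringE(1)[OF subring_S])

lemma S_eqI:
  assumes "f \<in> S" "g \<in> S" "\<And>x. x \<in> space M \<Longrightarrow> f x = g x"
  shows "f = g"
proof (rule extensionalityI[of _ "space M"])
  show "f \<in> extensional (space M)" "g \<in> extensional (space M)"
    using assms(1,2) S_subset by (auto simp: measurable_ring_def)
qed (fact assms(3))

lemma zero_set_sets:
  assumes "f \<in> S"
  shows "zero_set M f \<in> sets M"
proof -
  have "f \<in> borel_measurable M" using assms S_subset by (auto simp: measurable_ring_def)
  then show ?thesis unfolding zero_set_def by measurable
qed

lemma square_eq: "f \<in> S \<Longrightarrow> f [^] (2::nat) = f \<otimes> f"
  by (simp add: numeral_2_eq_2)

lemma zero_set_square: "zero_set M (f \<otimes> f) = zero_set M f"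
  by (auto simp: zero_set_def)

text \<open>The canonical element of \<open>S\<close> with zero set \<open>E\<close>. With the
  complement taken, enlarging \<open>E\<close> passes to a multiple of \<open>off E\<close>, in step
  with the upward closure of filters.\<close>

definition off :: "'a set \<Rightarrow> 'a \<Rightarrow> real" where
  "off E = (\<lambda>x\<in>space M. indicator (space M - E) x)"

lemma off_mem [simp]: "E \<in> sets M \<Longrightarrow> off E \<in> S"
  using chi_ring unfolding chi_ring_def off_def by blast

lemma off_apply [simp]: "x \<in> space M \<Longrightarrow> off E x = (if x \<in> E then 0 else 1)"
  by (simp add: off_def)

lemma mult_mem [simp]: "f \<in> S \<Longrightarrow> g \<in> S \<Longrightarrow> f \<otimes> g \<in> S"
  using m_closed by simp

lemma add_mem [simp]: "f \<in> S \<Longrightarrow> g \<in> S \<Longrightarrow> f \<oplus> g \<in> S"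
  using add.m_closed by simp

lemma one_mem [simp]: "\<one> \<in> S"
  using one_closed by simp

lemma zero_mem [simp]: "\<zero> \<in> S"
  using zero_closed by simp

lemma zero_set_off: "E \<in> sets M \<Longrightarrow> zero_set M (off E) = E"
  using sets.sets_into_space[of E M] by (auto simp: zero_set_def split: if_splits)

section \<open>Ideals and their families \<open>ZS_image M S I\<close>\<close>

lemma ideal_mult:
  assumes "ideal I R" "f \<in> I" "g \<in> S"
  shows "f \<otimes> g \<in> I"
  using ideal.I_r_closed[OF assms(1,2)] assms(3) by simp

lemma ideal_subset: "ideal I R \<Longrightarrow> f \<in> I \<Longrightarrow> f \<in> S"
  using ideal.Icarr by fastforce

text \<open>Turns ideal membership into a real equation at each point, usually settled by cases; the
  multiplier \<open>g\<close> is given explicitly.\<close>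

lemma ideal_mem_transfer:
  assumes "ideal I R" "f \<in> I" "g \<in> S" "h \<in> S" "\<And>x. x \<in> space M \<Longrightarrow> h x = f x * g x"
  shows "h \<in> I"
proof -
  have "h = f \<otimes> g"
    using assms ideal_subset by (intro S_eqI) auto
  then show ?thesis using ideal_mult assms by blast
qed

text \<open>If \<open>g\<close> inverts \<open>f\<close> outside \<open>E\<close>, then
  \<open>f\<close> times \<open>g \<otimes> off E\<close> is \<open>off E\<close>. Conversely
  \<open>off E\<close> equals 1 outside \<open>E\<close>, so \<open>\<one>\<close> serves as its
  inverse there.\<close>

lemma mem_ZS_image_iff:
  assumes "ideal I R"
  shows "E \<in> ZS_image M S I \<longleftrightarrow> E \<in> sets M \<and> off E \<in> I"
proof
  assume "E \<in> ZS_image M S I"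
  then obtain f g where fg: "f \<in> I" "g \<in> S" "E \<in> sets M"
    "\<And>x. x \<in> space M - E \<Longrightarrow> f x * g x = 1"
    unfolding ZS_image_def ZS_def by blast
  have "off E \<in> I"
    using assms fg(1) by (rule ideal_mem_transfer[where g = "g \<otimes> off E"]) (use fg in auto)
  with fg(3) show "E \<in> sets M \<and> off E \<in> I" by blast
next
  assume E: "E \<in> sets M \<and> off E \<in> I"
  then have "E \<in> ZS M S (off E)"
    unfolding ZS_def by (auto intro!: bexI[of _ \<one>])
  with E show "E \<in> ZS_image M S I" unfolding ZS_image_def by blast
qed

lemma ZS_image_superset:
  assumes "ideal I R" "E \<in> ZS_image M S I" "F \<in> sets M" "E \<subseteq> F"
  shows "F \<in> ZS_image M S I"
proof -
  have E: "E \<in> sets M" "off E \<in> I" using assms(1,2) by (auto simp: mem_ZS_image_iff)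
  have "off F \<in> I"
    using assms(1) E(2) by (rule ideal_mem_transfer[where g = "off F"]) (use assms in auto)
  with assms(1,3) show ?thesis by (simp add: mem_ZS_image_iff)
qed

text \<open>By \<open>mem_ZS_image_iff\<close> the filter axioms become statements about which
  \<open>off E\<close> lie in \<open>I\<close>; the empty set is excluded because
  \<open>off {} = \<one>\<close>.\<close>

lemma A_filter_ZS_image:
  assumes "proper_ideal I R"
  shows "A_filter M (ZS_image M S I)"
proof -
  have I: "ideal I R" and one: "\<one> \<notin> I"
    using assms by (auto simp: proper_ideal_iff_one_notin)
  interpret I: ideal I R by (rule I)
  have "off (space M) = \<zero>" by (rule S_eqI) auto
  then have "space M \<in> ZS_image M S I"
    using I.zero_closed by (simp add: mem_ZS_image_iff[OF I])
  moreover have "off {} = \<one>" by (rule S_eqI) auto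
  then have "{} \<notin> ZS_image M S I"
    using one by (simp add: mem_ZS_image_iff[OF I])
  moreover have "A \<inter> B \<in> ZS_image M S I"
    if AB: "A \<in> ZS_image M S I" "B \<in> ZS_image M S I" for A B
  proof -
    have A: "A \<in> sets M" "off A \<in> I" and B: "B \<in> sets M" "off B \<in> I"
      using AB by (auto simp: mem_ZS_image_iff[OF I])
    \<comment> \<open>The complement of \<open>A \<inter> B\<close> is the disjoint union of the
      complement of \<open>A\<close> and \<open>A - B\<close>.\<close>
    have "off (A \<inter> B) = off A \<oplus> off B \<otimes> off (space M - A)"
      using A(1) B(1) by (intro S_eqI) auto
    moreover have "off B \<otimes> off (space M - A) \<in> I"
      using A(1) by (intro ideal_mult[OF I B(2)]) simp
    ultimately have "off (A \<inter> B) \<in> I" using I.a_closed[OF A(2)] by simp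
    with A(1) B(1) show ?thesis by (simp add: mem_ZS_image_iff[OF I] sets.Int)
  qed
  moreover have "ZS_image M S I \<subseteq> sets M" by (auto simp: mem_ZS_image_iff[OF I])
  ultimately show ?thesis
    unfolding A_filter_def using ZS_image_superset[OF I] by blast
qed

section \<open>Zero sets in regular rings\<close>

text \<open>The same \<open>g\<close> serves both sides: the real number \<open>f x\<close> can be
  cancelled exactly where it is nonzero.\<close>

lemma von_neumann_regular_iff_zero_set:
  "von_neumann_regular R \<longleftrightarrow> (\<forall>f\<in>S. zero_set M f \<in> ZS M S f)"
proof -
  have "f = (f \<otimes> f) \<otimes> g \<longleftrightarrow> (\<forall>x\<in>space M - zero_set M f. f x * g x = 1)"
    if fg: "f \<in> S" "g \<in> S" for f g
  proof
    assume eq: "f = (f \<otimes> f) \<otimes> g"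
    show "\<forall>x\<in>space M - zero_set M f. f x * g x = 1"
    proof
      fix x assume x: "x \<in> space M - zero_set M f"
      then have "f x = (f x * f x) * g x" using arg_cong[OF eq, of "\<lambda>h. h x"] by simp
      with x show "f x * g x = 1" by (simp add: zero_set_def)
    qed
  next
    assume inv: "\<forall>x\<in>space M - zero_set M f. f x * g x = 1"
    show "f = (f \<otimes> f) \<otimes> g"
    proof (rule S_eqI)
      fix x assume "x \<in> space M"
      with inv show "f x = ((f \<otimes> f) \<otimes> g) x"
        by (cases "f x = 0") (auto simp: zero_set_def mult.assoc)
    qed (use fg in auto)
  qed
  then show ?thesis
    unfolding von_neumann_regular_def ZS_def using zero_set_sets by simp
qed

text \<open>Forwards, \<open>zero_set M f\<close> is in \<open>ZS M S f\<close>. Backwards,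
  \<open>f\<close> is a multiple of \<open>off (zero_set M f)\<close>, with multiplier
  \<open>f\<close> itself.\<close>

lemma von_neumann_regular_mem_iff:
  assumes "von_neumann_regular R" "ideal I R" "f \<in> S"
  shows "f \<in> I \<longleftrightarrow> zero_set M f \<in> ZS_image M S I"
proof
  assume "f \<in> I"
  with assms(1,3) show "zero_set M f \<in> ZS_image M S I"
    unfolding von_neumann_regular_iff_zero_set ZS_image_def by blast
next
  assume "zero_set M f \<in> ZS_image M S I"
  then have "off (zero_set M f) \<in> I" using assms(2) by (simp add: mem_ZS_image_iff)
  with assms(2) show "f \<in> I"
    by (rule ideal_mem_transfer[where g = f]) (use assms(3) in \<open>auto simp: zero_set_def\<close>)
qed

text \<open>Membership depends on the zero set alone and \<open>ZS_image M S I\<close> is closed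
  upwards. This yields divisibility results without computing multipliers.\<close>

lemma von_neumann_regular_zero_set_mono:
  assumes "von_neumann_regular R" "ideal I R" "f \<in> I" "g \<in> S" "zero_set M f \<subseteq> zero_set M g"
  shows "g \<in> I"
  using assms ZS_image_superset zero_set_sets von_neumann_regular_mem_iff ideal_subset by metis

text \<open>The square of a local inverse of \<open>f\<close> is a local inverse of
  \<open>f \<otimes> f\<close>. The set \<open>T\<close> is kept general to cover both
  \<open>ZS M S\<close> and \<open>ZM M\<close>.\<close>

lemma ZS_square:
  assumes "\<And>h. h \<in> T \<Longrightarrow> h \<otimes> h \<in> T"
  shows "ZS M T f \<subseteq> ZS M T (f \<otimes> f)"
proof
  fix E assume "E \<in> ZS M T f"
  then obtain h where h: "E \<in> sets M" "h \<in> T" "\<forall>x\<in>space M - E. f x * h x = 1"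
    unfolding ZS_def by blast
  have "(f \<otimes> f) x * (h \<otimes> h) x = 1" if "x \<in> space M - E" for x
  proof -
    have "(f \<otimes> f) x * (h \<otimes> h) x = (f x * h x) * (f x * h x)" using that by simp
    with h(3) that show ?thesis by simp
  qed
  with h assms show "E \<in> ZS M T (f \<otimes> f)" unfolding ZS_def by blast
qed

lemma mem_principal_iff: "g \<in> PIdl f \<longleftrightarrow> (\<exists>h\<in>S. g = h \<otimes> f)"
  unfolding cgenideal_def by auto

lemma principal_ideal: "f \<in> S \<Longrightarrow> ideal (PIdl f) R"
  using cgenideal_ideal by simp

lemma principal_self: "f \<in> S \<Longrightarrow> f \<in> PIdl f"
  using cgenideal_self by simp

lemma Idl_singleton: "f \<in> S \<Longrightarrow> Idl {f} = PIdl f"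
  using cgenideal_eq_genideal by simp

lemma von_neumann_regular_squareI:
  assumes "\<And>f. f \<in> S \<Longrightarrow> proper_ideal (PIdl (f \<otimes> f)) R \<Longrightarrow> f \<in> PIdl (f \<otimes> f)"
  shows "von_neumann_regular R"
  using assms by (intro von_neumann_regularI) simp

lemma von_neumann_regular_zero_set_image:
  assumes "von_neumann_regular R" "ideal I R"
  shows "zero_set M ` I = ZS_image M S I"
proof (intro equalityI subsetI)
  fix E assume "E \<in> zero_set M ` I"
  then show "E \<in> ZS_image M S I"
    using von_neumann_regular_mem_iff[OF assms] ideal_subset[OF assms(2)] by blast
next
  fix E assume "E \<in> ZS_image M S I"
  then show "E \<in> zero_set M ` I"
    using assms(2) zero_set_off by (metis imageI mem_ZS_image_iff)
qed

text \<open>In a regular ring the zero sets of \<open>I\<close> form exactly the filter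
  \<open>ZS_image M S I\<close>. For the converse, \<open>f\<close> shares its zero set with
  \<open>f \<otimes> f\<close>.\<close>

lemma von_neumann_regular_iff_zero_set_filter:
  "von_neumann_regular R \<longleftrightarrow>
    (\<forall>I. proper_ideal I R \<longrightarrow>
      A_filter M (zero_set M ` I) \<and> {f \<in> S. zero_set M f \<in> zero_set M ` I} = I)"
proof
  assume reg: "von_neumann_regular R"
  show "\<forall>I. proper_ideal I R \<longrightarrow>
    A_filter M (zero_set M ` I) \<and> {f \<in> S. zero_set M f \<in> zero_set M ` I} = I"
  proof (intro allI impI)
    fix I assume I: "proper_ideal I R"
    then have I': "ideal I R" unfolding proper_ideal_def ..
    have "{f \<in> S. zero_set M f \<in> ZS_image M S I} = I"
      using von_neumann_regular_mem_iff[OF reg I'] ideal_subset[OF I'] by blast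
    with A_filter_ZS_image[OF I]
    show "A_filter M (zero_set M ` I) \<and> {f \<in> S. zero_set M f \<in> zero_set M ` I} = I"
      unfolding von_neumann_regular_zero_set_image[OF reg I'] by blast
  qed
next
  assume *: "\<forall>I. proper_ideal I R \<longrightarrow>
    A_filter M (zero_set M ` I) \<and> {f \<in> S. zero_set M f \<in> zero_set M ` I} = I"
  show "von_neumann_regular R"
  proof (rule von_neumann_regular_squareI)
    fix f assume f: "f \<in> S" "proper_ideal (PIdl (f \<otimes> f)) R"
    have "zero_set M f \<in> zero_set M ` (PIdl (f \<otimes> f))"
      using principal_self[of "f \<otimes> f"] f(1) zero_set_square by (metis imageI mult_mem)
    with * f show "f \<in> PIdl (f \<otimes> f)" by blast
  qed
qed

text \<open>Intersections in \<open>F\<close> handle sums, supersets handle multiples, and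
  \<open>{} \<notin> F\<close> excludes \<open>\<one>\<close>.\<close>

lemma proper_ideal_zero_set_preimage:
  assumes "A_filter M F" "space M \<noteq> {}"
  shows "proper_ideal {f \<in> S. zero_set M f \<in> F} R"
proof -
  let ?I = "{f \<in> S. zero_set M f \<in> F}"
  have F: "F \<noteq> {}" "{} \<notin> F" "\<And>A B. A \<in> F \<Longrightarrow> B \<in> F \<Longrightarrow> A \<inter> B \<in> F"
    and up: "\<And>A B. A \<in> F \<Longrightarrow> B \<in> sets M \<Longrightarrow> A \<subseteq> B \<Longrightarrow> B \<in> F"
    using assms(1) unfolding A_filter_def by blast+
  have mono: "g \<in> ?I" if "f \<in> ?I" "g \<in> S" "zero_set M f \<subseteq> zero_set M g" for f g
    using that up zero_set_sets by blast
  \<comment> \<open>Closure under negation thereby becomes a case of closure under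
    multiples.\<close>
  have minus: "\<ominus> f = (\<ominus> \<one>) \<otimes> f" if "f \<in> S" for f
    using that by (simp add: l_minus)
  have mult: "g \<otimes> f \<in> ?I" if "f \<in> ?I" "g \<in> S" for f g
    using that(1) by (rule mono) (use that in \<open>auto simp: zero_set_def\<close>)
  have "ideal ?I R"
  proof (rule idealI[OF ring_axioms])
    show "subgroup ?I (add_monoid R)"
    proof (rule add.subgroupI)
      show "?I \<subseteq> carrier R" by auto
      obtain E where "E \<in> F" using F(1) by blast
      moreover from this have "E \<subseteq> space M"
        using assms(1) sets.sets_into_space unfolding A_filter_def by blast
      moreover have "zero_set M \<zero> = space M" by (auto simp: zero_set_def)
      ultimately have "zero_set M \<zero> \<in> F" using up[of E "space M"] by simp
      then show "?I \<noteq> {}" using zero_mem by blast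
      show "\<ominus> f \<in> ?I" if "f \<in> ?I" for f
        using mult[OF that, of "\<ominus> \<one>"] minus[of f] that a_inv_closed[OF one_closed] by simp
      show "f \<oplus> g \<in> ?I" if fg: "f \<in> ?I" "g \<in> ?I" for f g
      proof -
        have "zero_set M f \<inter> zero_set M g \<in> F" using fg F(3) by blast
        moreover have "zero_set M f \<inter> zero_set M g \<subseteq> zero_set M (f \<oplus> g)"
          by (auto simp: zero_set_def)
        moreover have "f \<oplus> g \<in> S" using fg by simp
        ultimately show ?thesis using up zero_set_sets by blast
      qed
    qed
  next
    fix f g assume "f \<in> ?I" "g \<in> carrier R"
    then show "g \<otimes> f \<in> ?I" "f \<otimes> g \<in> ?I"
      using mult[of f g] m_comm[of f g] by auto
  qed
  moreover have "zero_set M \<one> = {}" by (auto simp: zero_set_def)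
  ultimately show ?thesis using F(2) by (simp add: proper_ideal_iff_one_notin)
qed

lemma zero_set_image_preimage:
  assumes "F \<subseteq> sets M"
  shows "zero_set M ` {f \<in> S. zero_set M f \<in> F} = F"
proof (intro equalityI subsetI)
  fix E assume E: "E \<in> F"
  with assms have "zero_set M (off E) = E" "off E \<in> S" using zero_set_off by auto
  with E show "E \<in> zero_set M ` {f \<in> S. zero_set M f \<in> F}"
    by (intro image_eqI[of _ _ "off E"]) auto
qed auto

text \<open>In the regular case the inverse map sends a filter to the functions whose zero sets it
  contains. Conversely injectivity suffices: \<open>PIdl f\<close> and
  \<open>PIdl (f \<otimes> f)\<close> have the same zero sets.\<close>

lemma von_neumann_regular_iff_bij_betw:
  assumes "space M \<noteq> {}"
  shows "von_neumann_regular R \<longleftrightarrow>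
    bij_betw (\<lambda>I. zero_set M ` I) {I. proper_ideal I R} {F. A_filter M F}"
proof
  assume "von_neumann_regular R"
  then have *: "A_filter M (zero_set M ` I)" "{f \<in> S. zero_set M f \<in> zero_set M ` I} = I"
    if "proper_ideal I R" for I
    using that unfolding von_neumann_regular_iff_zero_set_filter by blast+
  show "bij_betw (\<lambda>I. zero_set M ` I) {I. proper_ideal I R} {F. A_filter M F}"
  proof (rule bij_betw_byWitness[where f' = "\<lambda>F. {f \<in> S. zero_set M f \<in> F}"])
    show "\<forall>F\<in>{F. A_filter M F}. zero_set M ` {f \<in> S. zero_set M f \<in> F} = F"
      using zero_set_image_preimage unfolding A_filter_def by blast
  qed (use * proper_ideal_zero_set_preimage assms in auto)
next
  assume "bij_betw (\<lambda>I. zero_set M ` I) {I. proper_ideal I R} {F. A_filter M F}"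
  then have inj: "inj_on (\<lambda>I. zero_set M ` I) {I. proper_ideal I R}"
    by (rule bij_betw_imp_inj_on)
  show "von_neumann_regular R"
  proof (rule von_neumann_regular_squareI)
    fix f assume f: "f \<in> S" "proper_ideal (PIdl (f \<otimes> f)) R"
    \<comment> \<open>Injectivity concerns proper ideals, so \<open>PIdl f\<close> must be proper
      too; an inverse of \<open>f\<close> would square to one of
      \<open>f \<otimes> f\<close>.\<close>
    have "\<one> \<notin> PIdl f"
    proof
      assume "\<one> \<in> PIdl f"
      then obtain h where h: "h \<in> S" "\<one> = h \<otimes> f" unfolding mem_principal_iff by blast
      have "\<one> = (h \<otimes> f) \<otimes> (h \<otimes> f)" by (simp flip: h(2))
      also have "\<dots> = (h \<otimes> h) \<otimes> (f \<otimes> f)" using h(1) f(1) by (simp add: m_ac)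
      finally have "\<one> \<in> PIdl (f \<otimes> f)" unfolding mem_principal_iff using h(1) mult_mem by blast
      with f(2) show False by (simp add: proper_ideal_iff_one_notin)
    qed
    then have "proper_ideal (PIdl f) R"
      using principal_ideal[OF f(1)] by (simp add: proper_ideal_iff_one_notin)
    moreover have "zero_set M ` (PIdl f) = zero_set M ` (PIdl (f \<otimes> f))"
    proof -
      have PIdl: "PIdl g = (\<lambda>h. h \<otimes> g) ` S" for g
        unfolding cgenideal_def by auto
      have "zero_set M (h \<otimes> f) = zero_set M (h \<otimes> (f \<otimes> f))" for h
        by (auto simp: zero_set_def)
      then show ?thesis by (simp add: PIdl image_image)
    qed
    ultimately have "PIdl f = PIdl (f \<otimes> f)" using inj_onD[OF inj] f(2) by simp
    with principal_self[OF f(1)] show "f \<in> PIdl (f \<otimes> f)" by simp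
  qed
qed

text \<open>Over the reals \<open>f \<otimes> f \<oplus> g \<otimes> g\<close> vanishes exactly
  where both functions do, so zero set monotonicity puts \<open>f\<close> and \<open>g\<close> into
  its ideal. The converse takes \<open>g = \<zero>\<close>.\<close>

lemma von_neumann_regular_iff_sum_of_squares:
  "von_neumann_regular R \<longleftrightarrow>
    (\<forall>f\<in>S. \<forall>g\<in>S. Idl {f, g} = Idl {f [^] (2::nat) \<oplus> g [^] (2::nat)})"
proof
  assume reg: "von_neumann_regular R"
  show "\<forall>f\<in>S. \<forall>g\<in>S. Idl {f, g} = Idl {f [^] (2::nat) \<oplus> g [^] (2::nat)}"
  proof (intro ballI)
    fix f g assume fg: "f \<in> S" "g \<in> S"
    let ?h = "f \<otimes> f \<oplus> g \<otimes> g"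
    have h: "?h \<in> S" using fg by simp
    have I: "ideal (Idl {f, g}) R" using fg by (intro genideal_ideal) simp
    then interpret I: ideal "Idl {f, g}" R .
    have fgI: "f \<in> Idl {f, g}" "g \<in> Idl {f, g}"
      using genideal_self[of "{f, g}"] fg by auto
    have J: "ideal (Idl {?h}) R" using h by (intro genideal_ideal) simp
    have hJ: "?h \<in> Idl {?h}" using h by (intro genideal_self') simp
    have "?h \<in> Idl {f, g}"
      using ideal_mult[OF I fgI(1) fg(1)] ideal_mult[OF I fgI(2) fg(2)] by (rule I.a_closed)
    moreover have "f \<in> Idl {?h}" "g \<in> Idl {?h}"
      by (rule von_neumann_regular_zero_set_mono[OF reg J hJ];
          use fg in \<open>auto simp: zero_set_def sum_squares_eq_zero_iff\<close>)+
    ultimately have "Idl {f, g} = Idl {?h}"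
      using genideal_minimal[OF I, of "{?h}"] genideal_minimal[OF J, of "{f, g}"] by blast
    with fg show "Idl {f, g} = Idl {f [^] (2::nat) \<oplus> g [^] (2::nat)}"
      by (simp add: square_eq)
  qed
next
  assume *: "\<forall>f\<in>S. \<forall>g\<in>S. Idl {f, g} = Idl {f [^] (2::nat) \<oplus> g [^] (2::nat)}"
  show "von_neumann_regular R"
  proof (rule von_neumann_regular_squareI)
    fix f assume f: "f \<in> S"
    have "Idl {f, \<zero>} = Idl {f [^] (2::nat) \<oplus> \<zero> [^] (2::nat)}" using * f zero_mem by blast
    also have "\<dots> = PIdl (f \<otimes> f)" using f by (simp add: square_eq Idl_singleton)
    finally show "f \<in> PIdl (f \<otimes> f)" using genideal_self[of "{f, \<zero>}"] f by auto
  qed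
qed

section \<open>Zero sets in prime and maximal ideals\<close>

text \<open>A maximal ideal containing the auxiliary element \<open>u\<close> would contain
  \<open>f\<close>, hence by hypothesis \<open>off ?Z\<close>, and also the characteristic function
  of \<open>?Z\<close>. These two add up to \<open>\<one>\<close>, so \<open>u\<close> is a
  unit.\<close>

lemma maximal_zero_set_imp_von_neumann_regular:
  assumes max: "\<And>N f. maximalideal N R \<Longrightarrow> f \<in> N \<Longrightarrow> zero_set M f \<in> ZS_image M S N"
  shows "von_neumann_regular R"
  unfolding von_neumann_regular_iff_zero_set
proof
  fix f assume f: "f \<in> S"
  let ?Z = "zero_set M f"
  have Z: "?Z \<in> sets M" "space M - ?Z \<in> sets M" using zero_set_sets[OF f] by auto
  \<comment> \<open>\<open>u\<close> is a unit exactly if \<open>f\<close> is invertible off its zero set.\<close>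
  define u where "u = f \<oplus> off (space M - ?Z)"
  have u: "u \<in> S" unfolding u_def using f Z by simp
  have "\<one> \<in> PIdl u"
  proof (rule ccontr)
    assume "\<one> \<notin> PIdl u"
    then have "proper_ideal (PIdl u) R" using principal_ideal[OF u] by (simp add: proper_ideal_iff_one_notin)
    then obtain N where N: "maximalideal N R" "PIdl u \<subseteq> N" by (rule exists_maximalideal_above)
    interpret N: maximalideal N R by (rule N(1))
    have uN: "u \<in> N" using N(2) principal_self[OF u] by blast
    \<comment> \<open>Multiplying \<open>u\<close> by \<open>off ?Z\<close> removes the added
      characteristic function and leaves \<open>f\<close>; the complementary multiplier used below
      leaves that function alone.\<close>
    have "f \<in> N"
      using N.is_ideal uN by (rule ideal_mem_transfer[where g = "off ?Z"])
        (use f Z in \<open>auto simp: u_def zero_set_def\<close>)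
    then have "off ?Z \<in> N"
      using max[OF N(1)] by (simp add: mem_ZS_image_iff[OF N.is_ideal])
    moreover have "off (space M - ?Z) \<in> N"
      using N.is_ideal uN by (rule ideal_mem_transfer[where g = "off (space M - ?Z)"])
        (use f Z in \<open>auto simp: u_def zero_set_def\<close>)
    ultimately have "off ?Z \<oplus> off (space M - ?Z) \<in> N" by (rule N.a_closed)
    moreover have "off ?Z \<oplus> off (space M - ?Z) = \<one>"
      using Z by (intro S_eqI) auto
    ultimately show False using N.one_imp_carrier N.I_notcarr by simp
  qed
  then obtain h where h: "h \<in> S" "\<one> = h \<otimes> u" unfolding mem_principal_iff by blast
  \<comment> \<open>Outside \<open>?Z\<close> the functions \<open>u\<close> and \<open>f\<close>
    agree, so the inverse of \<open>u\<close> serves for \<open>f\<close>.\<close>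
  have "f x * h x = 1" if "x \<in> space M - ?Z" for x
  proof -
    have "1 = (h \<otimes> u) x" using that by (simp flip: h(2))
    with that show ?thesis by (simp add: u_def mult.commute)
  qed
  with h(1) Z(1) show "?Z \<in> ZS M S f" unfolding ZS_def by blast
qed

text \<open>A cycle: regularity gives the condition for primes, this covers maximal ideals, and
  those give regularity back.\<close>

lemma von_neumann_regular_iff_prime_zero_set:
  "von_neumann_regular R \<longleftrightarrow>
    (\<forall>P f. primeideal P R \<and> f \<in> P \<longrightarrow> zero_set M f \<in> ZS_image M S P)"
  using von_neumann_regular_mem_iff ideal_subset maximal_zero_set_imp_von_neumann_regular
    maximalideal_prime primeideal.axioms(1) by metis

lemma von_neumann_regular_iff_maximal_zero_set:
  "von_neumann_regular R \<longleftrightarrow>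
    (\<forall>N f. maximalideal N R \<and> f \<in> N \<longrightarrow> zero_set M f \<in> ZS_image M S N)"
  using von_neumann_regular_mem_iff ideal_subset maximal_zero_set_imp_von_neumann_regular
    maximalideal.axioms(1) by metis

section \<open>Divisibility and ideals recovered from \<open>ZS_image\<close>\<close>

text \<open>Forwards, zero set monotonicity is applied to \<open>PIdl f\<close>. Backwards, equal
  zero sets make \<open>f \<otimes> f\<close> divide \<open>f\<close>.\<close>

lemma von_neumann_regular_iff_divides:
  "von_neumann_regular R \<longleftrightarrow>
    (\<forall>f\<in>S. \<forall>g\<in>S. zero_set M f \<subseteq> zero_set M g \<longrightarrow> f divides g)"
proof
  assume reg: "von_neumann_regular R"
  show "\<forall>f\<in>S. \<forall>g\<in>S. zero_set M f \<subseteq> zero_set M g \<longrightarrow> f divides g"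
  proof (intro ballI impI)
    fix f g assume fg: "f \<in> S" "g \<in> S" "zero_set M f \<subseteq> zero_set M g"
    have "g \<in> PIdl f"
      using von_neumann_regular_zero_set_mono[OF reg principal_ideal principal_self] fg by blast
    then obtain h where "h \<in> S" "g = f \<otimes> h"
      unfolding mem_principal_iff using fg(1) m_comm by auto
    then show "f divides g" unfolding factor_def by auto
  qed
next
  assume "\<forall>f\<in>S. \<forall>g\<in>S. zero_set M f \<subseteq> zero_set M g \<longrightarrow> f divides g"
  then have "(f \<otimes> f) divides f" if "f \<in> S" for f
    using that zero_set_square by simp
  then show "von_neumann_regular R"
    unfolding von_neumann_regular_def factor_def by simp
qed

text \<open>In a regular ring \<open>ZS M S f\<close> has \<open>zero_set M f\<close> as a member,
  which decides membership of \<open>f\<close>. The converse rests on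
  \<open>ZS_square\<close>.\<close>

lemma von_neumann_regular_iff_ZS_ideals:
  "von_neumann_regular R \<longleftrightarrow> (\<forall>I. proper_ideal I R \<longrightarrow> ZS_ideal M S I)"
proof
  assume reg: "von_neumann_regular R"
  show "\<forall>I. proper_ideal I R \<longrightarrow> ZS_ideal M S I"
  proof (intro allI impI)
    fix I assume I: "proper_ideal I R"
    then have "f \<in> I" if "f \<in> S" "ZS M S f \<subseteq> ZS_image M S I" for f
      using that reg von_neumann_regular_mem_iff[OF reg _ that(1)]
      unfolding proper_ideal_def von_neumann_regular_iff_zero_set by blast
    with I show "ZS_ideal M S I" unfolding ZS_ideal_def R_eq by blast
  qed
next
  assume *: "\<forall>I. proper_ideal I R \<longrightarrow> ZS_ideal M S I"
  show "von_neumann_regular R"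
  proof (rule von_neumann_regular_squareI)
    fix f assume f: "f \<in> S" "proper_ideal (PIdl (f \<otimes> f)) R"
    have "ZS M S f \<subseteq> ZS M S (f \<otimes> f)" by (rule ZS_square) simp
    also have "\<dots> \<subseteq> ZS_image M S (PIdl (f \<otimes> f))"
      unfolding ZS_image_def using principal_self[of "f \<otimes> f"] f(1) by auto
    finally show "f \<in> PIdl (f \<otimes> f)" using * f unfolding ZS_ideal_def by blast
  qed
qed

lemma von_neumann_regular_iff_ZM_preimage:
  "von_neumann_regular R \<longleftrightarrow>
    (\<forall>I. proper_ideal I R \<longrightarrow> I = ZM_preimage M (ZS_image M S I) \<inter> S)"
proof
  assume reg: "von_neumann_regular R"
  show "\<forall>I. proper_ideal I R \<longrightarrow> I = ZM_preimage M (ZS_image M S I) \<inter> S"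
  proof (intro allI impI equalityI subsetI)
    fix I f assume I: "proper_ideal I R" and f: "f \<in> I"
    then have I': "ideal I R" unfolding proper_ideal_def by blast
    have fS: "f \<in> S" using I' f by (rule ideal_subset)
    have "E \<in> ZS_image M S I" if "E \<in> ZM M f" for E
    proof (rule ZS_image_superset[OF I'])
      show "zero_set M f \<in> ZS_image M S I"
        using von_neumann_regular_mem_iff[OF reg I' fS] f by blast
      show "E \<in> sets M" using that unfolding ZS_def by blast
      \<comment> \<open>A function invertible outside \<open>E\<close> cannot vanish there.\<close>
      show "zero_set M f \<subseteq> E" using that unfolding ZS_def zero_set_def by force
    qed
    with fS S_subset show "f \<in> ZM_preimage M (ZS_image M S I) \<inter> S"
      unfolding ZM_preimage_def by blast
  next
    fix I f assume I: "proper_ideal I R" and f: "f \<in> ZM_preimage M (ZS_image M S I) \<inter> S"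
    have "zero_set M f \<in> ZS M S f"
      using reg f unfolding von_neumann_regular_iff_zero_set by blast
    then have "zero_set M f \<in> ZM M f" using S_subset unfolding ZS_def by blast
    with f have "zero_set M f \<in> ZS_image M S I" unfolding ZM_preimage_def by blast
    with reg I f show "f \<in> I" unfolding proper_ideal_def using von_neumann_regular_mem_iff by blast
  qed
next
  assume *: "\<forall>I. proper_ideal I R \<longrightarrow> I = ZM_preimage M (ZS_image M S I) \<inter> S"
  show "von_neumann_regular R"
  proof (rule von_neumann_regular_squareI)
    fix f assume f: "f \<in> S" "proper_ideal (PIdl (f \<otimes> f)) R"
    let ?I = "PIdl (f \<otimes> f)"
    have eq: "?I = ZM_preimage M (ZS_image M S ?I) \<inter> S" using * f(2) by blast
    \<comment> \<open>\<open>R\<close> and the full measurable ring share their multiplication, so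
      \<open>ZS_square\<close> also applies to the full carrier.\<close>
    have "h \<otimes> h \<in> carrier (measurable_ring M)" if "h \<in> carrier (measurable_ring M)" for h
      using monoid.m_closed[OF ring.is_monoid[OF cring.axioms(1)[OF cring_measurable_ring]] that that]
      by (simp add: R_eq)
    then have "ZM M f \<subseteq> ZM M (f \<otimes> f)" by (rule ZS_square)
    also have "\<dots> \<subseteq> ZS_image M S ?I"
    proof -
      have "f \<otimes> f \<in> ?I" using f(1) by (simp add: principal_self)
      then have "f \<otimes> f \<in> ZM_preimage M (ZS_image M S ?I) \<inter> S" using eq by simp
      then show ?thesis unfolding ZM_preimage_def by blast
    qed
    finally have "f \<in> ZM_preimage M (ZS_image M S ?I) \<inter> S"
      unfolding ZM_preimage_def using f(1) S_subset by blast
    then show "f \<in> ?I" using eq by simp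
  qed
qed

text \<open>Powers are pointwise and the reals have no nilpotents. For \<open>n = 0\<close> the
  equation forces \<open>1 = 0\<close> at every point.\<close>

lemma reduced:
  assumes "f \<in> S" "f [^] (n::nat) = \<zero>"
  shows "f = \<zero>"
proof (rule S_eqI)
  fix x assume x: "x \<in> space M"
  have "(f [^] k) x = f x ^ k" for k :: nat
    using x by (induction k) simp_all
  with assms(2) x have "f x ^ n = 0" by (metis ring_apply(4))
  with x show "f x = \<zero> x" by simp
qed (use assms in auto)

lemma von_neumann_regular_iff_prime_maximal:
  "von_neumann_regular R \<longleftrightarrow> (\<forall>P. primeideal P R \<longrightarrow> maximalideal P R)"
proof
  assume "\<forall>P. primeideal P R \<longrightarrow> maximalideal P R"
  then show "von_neumann_regular R"
    by (intro reduced_prime_maximal_imp_von_neumann_regular) (auto intro: reduced)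
qed (use von_neumann_regular_imp_prime_maximal in blast)

end

section \<open>Combining the equivalences\<close>

text \<open>A pivot \<open>q\<close> replaces all pairwise comparisons by one equivalence per entry;
  it will be \<open>von_neumann_regular R\<close>.\<close>

lemma all_equivalentI: "(\<And>p. p \<in> set ps \<Longrightarrow> q \<longleftrightarrow> p) \<Longrightarrow> all_equivalent ps"
  unfolding all_equivalent_def by blast

theorem theorem4p4:
  fixes M :: "'a measure" and S :: "('a \<Rightarrow> real) set" and R :: "('a \<Rightarrow> real) ring"
  assumes "space M \<noteq> {}"
    and "chi_ring M S"
    and "R = ring_on M S"
  shows "all_equivalent
   [\<forall>P. primeideal P R \<longrightarrow> maximalideal P R,
    \<forall>f\<in>S. \<exists>g\<in>S. f = (f [^]\<^bsub>R\<^esub> (2::nat)) \<otimes>\<^bsub>R\<^esub> g,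
    \<forall>f\<in>S. zero_set M f \<in> ZS M S f,
    \<forall>I. proper_ideal I R \<longrightarrow>
      A_filter M (zero_set M ` I) \<and> {f \<in> S. zero_set M f \<in> zero_set M ` I} = I,
    bij_betw (\<lambda>I. zero_set M ` I) {I. proper_ideal I R} {F. A_filter M F},
    \<forall>f\<in>S. \<forall>g\<in>S. Idl\<^bsub>R\<^esub> {f, g} = Idl\<^bsub>R\<^esub> {f [^]\<^bsub>R\<^esub> (2::nat) \<oplus>\<^bsub>R\<^esub> g [^]\<^bsub>R\<^esub> (2::nat)},
    \<forall>P f. primeideal P R \<and> f \<in> P \<longrightarrow> zero_set M f \<in> ZS_image M S P,
    \<forall>N f. maximalideal N R \<and> f \<in> N \<longrightarrow> zero_set M f \<in> ZS_image M S N,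
    \<forall>f\<in>S. \<forall>g\<in>S. zero_set M f \<subseteq> zero_set M g \<longrightarrow> f divides\<^bsub>R\<^esub> g,
    \<forall>I. proper_ideal I R \<longrightarrow> ZS_ideal M S I,
    \<forall>J. principalideal J R \<longrightarrow> (\<exists>e\<in>S. e \<otimes>\<^bsub>R\<^esub> e = e \<and> J = Idl\<^bsub>R\<^esub> {e}),
    \<forall>I. proper_ideal I R \<longrightarrow> I = S \<inter> \<Inter>{P. primeideal P R \<and> I \<subseteq> P},
    \<forall>I. proper_ideal I R \<longrightarrow> I = S \<inter> \<Inter>{N. maximalideal N R \<and> I \<subseteq> N},
    \<forall>I. proper_ideal I R \<longrightarrow> I = ZM_preimage M (ZS_image M S I) \<inter> S,
    \<forall>I. proper_ideal I R \<longrightarrow> Z_ideal I R]"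
proof -
  interpret chi_subring M S R
    using assms(2,3) by unfold_locales
  \<comment> \<open>The list entry uses the power \<open>[^] 2\<close>, the pivot the product of
    \<open>f\<close> with itself.\<close>
  have square: "von_neumann_regular R \<longleftrightarrow>
      (\<forall>f\<in>S. \<exists>g\<in>S. f = (f [^]\<^bsub>R\<^esub> (2::nat)) \<otimes>\<^bsub>R\<^esub> g)"
    unfolding von_neumann_regular_def by (simp add: square_eq)
  note equivalences =
    von_neumann_regular_iff_prime_maximal
    square
    von_neumann_regular_iff_zero_set
    von_neumann_regular_iff_zero_set_filter
    von_neumann_regular_iff_bij_betw[OF assms(1)]
    von_neumann_regular_iff_sum_of_squares
    von_neumann_regular_iff_prime_zero_set
    von_neumann_regular_iff_maximal_zero_set
    von_neumann_regular_iff_divides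
    von_neumann_regular_iff_ZS_ideals
    von_neumann_regular_iff_idempotent_generators[unfolded carrier_eq]
    von_neumann_regular_iff_Inter_primes[unfolded carrier_eq]
    von_neumann_regular_iff_Inter_maximals[unfolded carrier_eq]
    von_neumann_regular_iff_ZM_preimage
    von_neumann_regular_iff_Z_ideals
  \<comment> \<open>After splitting membership in the list, each entry is rewritten to the pivot by
    its equivalence read from right to left.\<close>
  show ?thesis
    by (rule all_equivalentI[of _ "von_neumann_regular R"])
      (simp only: list.set insert_iff empty_iff, elim disjE FalseE; simp only: equivalences[symmetric])
qed

end
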